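(* Let $A$ be a commutative ring. Suppose that there exists $\lambda\in A^\times$ such that $\lambda^2-1\in A^\times$. Let $a,b\in A^\times$. Then $$F(a,b)_\lambda:=[R_a|R_b]+[R_aR_b|(R_aR_b)^{-1}R_{ab}]+\Theta_a+\Theta_b-\Theta_{ab}-\Theta_1+\Psi_{ab+(ab)^{-1}}-\Psi_{a+a^{-1}}-\Psi_{b+b^{-1}}+\Psi_2-\Psi_{-1}+\Psi_{(ab)^{-1}(a+b^{-1}-1)}\in\bar F_2(SL_2(A))$$ is a cycle, representing a homology class $C(a,b)_\lambda\in H_2(SL_2(A),\mathbb{Z})$.
   Context: Bar complex: for a group $G$, $\bar F_n(G)$ is the free abelian group on symbols $[g_n|\cdots|g_1]$ with $g_i\in G$ (the bar resolution of $\mathbb{Z}$ over $\mathbb{Z}[G]$ tensored with $\mathbb{Z}$), with $d_2([g|h])=[g]+[h]-[gh]$; $H_n(G,\mathbb{Z})=H_n(\bar F_\bullet(G))$. Matrices in $SL_2(A)$: $E_{12}(x)=\begin{pmatrix}1&x\\ 0&1\end{pmatrix}$ for $x\in A$, $D(u)=\begin{pmatrix}u&0\\ 0&u^{-1}\end{pmatrix}$ for $u\in A^\times$, $w=\begin{pmatrix}0&1\\ -1&0\end{pmatrix}$, and for $a\in A^\times$: $G_a=\begin{pmatrix}0&-1\\ 1&a+a^{-1}\end{pmatrix}$, $H_a=\begin{pmatrix}1&0\\ a&1\end{pmatrix}$, $R_a=H_aG_aH_a^{-1}=\begin{pmatrix}a&-1\\ 0&a^{-1}\end{pmatrix}$.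 Chains in $\bar F_2(SL_2(A))$: $\Theta_a=[H_a|G_a]-[R_a|H_a]+[w^{-1}|wG_a]$ for $a\in A^\times$; and for $x\in A$, with $x'=x/(\lambda^2-1)$, $\Psi_x=\Psi_{x,\lambda}=[E_{12}(x)|E_{12}(x')D(\lambda)]-[D(\lambda)|E_{12}(x')]+[E_{12}(x')|D(\lambda)]$.
   Formalization: The last term of F(a,b)_λ is taken with a minus sign, −Ψ_y with y=(ab)^{-1}(a+b^{-1}−1), instead of the printed +Ψ_y; with the plus sign the boundary is 2[E_{12}(y)], which is never zero. *)

theory Defs
  imports "HOL-Algebra.Algebra"
begin

section \<open>The bar complex of a group and its homology\<close>

text \<open>The symbol $[g_n|\cdots|g_1]$ is the list \<open>[g_n, \<dots>, g_1]\<close>. Chains are written with the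
  additive operations of the type of integer combinations of lists; the group operation of
  \<^const>\<open>free_Abelian_group\<close> is that addition.\<close>

definition bar_chain_group :: "('g, 'm) monoid_scheme \<Rightarrow> nat \<Rightarrow> ('g list \<Rightarrow>\<^sub>0 int) monoid" where
  "bar_chain_group G n = free_Abelian_group {gs. length gs = n \<and> set gs \<subseteq> carrier G}"

definition bar_face :: "('g, 'm) monoid_scheme \<Rightarrow> 'g list \<Rightarrow> nat \<Rightarrow> 'g list" where
  "bar_face G gs i =
     (if i = 0 then tl gs
      else if i = length gs then butlast gs
      else take (i - 1) gs @ [gs ! (i - 1) \<otimes>\<^bsub>G\<^esub> gs ! i] @ drop (i + 1) gs)"

text \<open>All the differentials at once, the degree being the length of the list; the differential
  leaving degree \<open>0\<close> is zero.\<close>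

definition bar_boundary :: "('g, 'm) monoid_scheme \<Rightarrow> ('g list \<Rightarrow>\<^sub>0 int) \<Rightarrow> ('g list \<Rightarrow>\<^sub>0 int)" where
  "bar_boundary G =
     frag_extend (\<lambda>gs. if gs = [] then 0
                       else \<Sum>i\<le>length gs. frag_cmul ((-1) ^ i) (frag_of (bar_face G gs i)))"

lemma bar_boundary_degree_2:
  "bar_boundary G (frag_of [g, h]) = frag_of [g] + frag_of [h] - frag_of [g \<otimes>\<^bsub>G\<^esub> h]"
  by (simp add: bar_boundary_def bar_face_def frag_extend_of eval_nat_numeral)

text \<open>In degree \<open>0\<close> the truncated \<open>n - 1\<close> is harmless, the differential being zero there.\<close>

definition bar_cycles :: "('g, 'm) monoid_scheme \<Rightarrow> nat \<Rightarrow> ('g list \<Rightarrow>\<^sub>0 int) set" where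
  "bar_cycles G n = kernel (bar_chain_group G n) (bar_chain_group G (n - 1)) (bar_boundary G)"

definition bar_boundaries :: "('g, 'm) monoid_scheme \<Rightarrow> nat \<Rightarrow> ('g list \<Rightarrow>\<^sub>0 int) set" where
  "bar_boundaries G n = bar_boundary G ` carrier (bar_chain_group G (Suc n))"

definition group_homology :: "('g, 'm) monoid_scheme \<Rightarrow> nat \<Rightarrow> ('g list \<Rightarrow>\<^sub>0 int) set monoid" where
  "group_homology G n = (bar_chain_group G n)\<lparr>carrier := bar_cycles G n\<rparr> Mod bar_boundaries G n"

definition homology_class ::
    "('g, 'm) monoid_scheme \<Rightarrow> nat \<Rightarrow> ('g list \<Rightarrow>\<^sub>0 int) \<Rightarrow> ('g list \<Rightarrow>\<^sub>0 int) set" where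
  "homology_class G n z = bar_boundaries G n #>\<^bsub>bar_chain_group G n\<^esub> z"

section \<open>The group $SL_2(A)$\<close>

text \<open>\<open>Mat2 p q r s\<close> has rows \<open>(p, q)\<close> and \<open>(r, s)\<close>. The matrices of HOL-Analysis need entries in a
  type of class \<open>comm_ring_1\<close>, which would exclude the zero ring.\<close>

datatype 'a mat2 = Mat2 'a 'a 'a 'a

fun mat2_mult :: "('a, 'm) ring_scheme \<Rightarrow> 'a mat2 \<Rightarrow> 'a mat2 \<Rightarrow> 'a mat2" where
  "mat2_mult A (Mat2 p q r s) (Mat2 p' q' r' s') =
     Mat2 (p \<otimes>\<^bsub>A\<^esub> p' \<oplus>\<^bsub>A\<^esub> q \<otimes>\<^bsub>A\<^esub> r') (p \<otimes>\<^bsub>A\<^esub> q' \<oplus>\<^bsub>A\<^esub> q \<otimes>\<^bsub>A\<^esub> s')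
          (r \<otimes>\<^bsub>A\<^esub> p' \<oplus>\<^bsub>A\<^esub> s \<otimes>\<^bsub>A\<^esub> r') (r \<otimes>\<^bsub>A\<^esub> q' \<oplus>\<^bsub>A\<^esub> s \<otimes>\<^bsub>A\<^esub> s')"

fun mat2_det :: "('a, 'm) ring_scheme \<Rightarrow> 'a mat2 \<Rightarrow> 'a" where
  "mat2_det A (Mat2 p q r s) = p \<otimes>\<^bsub>A\<^esub> s \<ominus>\<^bsub>A\<^esub> q \<otimes>\<^bsub>A\<^esub> r"

definition SL2 :: "('a, 'm) ring_scheme \<Rightarrow> 'a mat2 monoid" where
  "SL2 A = \<lparr>carrier = {M. set_mat2 M \<subseteq> carrier A \<and> mat2_det A M = \<one>\<^bsub>A\<^esub>},
            monoid.mult = mat2_mult A,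
            one = Mat2 \<one>\<^bsub>A\<^esub> \<zero>\<^bsub>A\<^esub> \<zero>\<^bsub>A\<^esub> \<one>\<^bsub>A\<^esub>\<rparr>"

definition E12 :: "('a, 'm) ring_scheme \<Rightarrow> 'a \<Rightarrow> 'a mat2" where
  "E12 A x = Mat2 \<one>\<^bsub>A\<^esub> x \<zero>\<^bsub>A\<^esub> \<one>\<^bsub>A\<^esub>"

definition Dmat :: "('a, 'm) ring_scheme \<Rightarrow> 'a \<Rightarrow> 'a mat2" where
  "Dmat A u = Mat2 u \<zero>\<^bsub>A\<^esub> \<zero>\<^bsub>A\<^esub> (inv\<^bsub>A\<^esub> u)"

definition wmat :: "('a, 'm) ring_scheme \<Rightarrow> 'a mat2" where
  "wmat A = Mat2 \<zero>\<^bsub>A\<^esub> \<one>\<^bsub>A\<^esub> (\<ominus>\<^bsub>A\<^esub> \<one>\<^bsub>A\<^esub>) \<zero>\<^bsub>A\<^esub>"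

definition Gmat :: "('a, 'm) ring_scheme \<Rightarrow> 'a \<Rightarrow> 'a mat2" where
  "Gmat A a = Mat2 \<zero>\<^bsub>A\<^esub> (\<ominus>\<^bsub>A\<^esub> \<one>\<^bsub>A\<^esub>) \<one>\<^bsub>A\<^esub> (a \<oplus>\<^bsub>A\<^esub> inv\<^bsub>A\<^esub> a)"

definition Hmat :: "('a, 'm) ring_scheme \<Rightarrow> 'a \<Rightarrow> 'a mat2" where
  "Hmat A a = Mat2 \<one>\<^bsub>A\<^esub> \<zero>\<^bsub>A\<^esub> a \<one>\<^bsub>A\<^esub>"

definition Rmat :: "('a, 'm) ring_scheme \<Rightarrow> 'a \<Rightarrow> 'a mat2" where
  "Rmat A a = Hmat A a \<otimes>\<^bsub>SL2 A\<^esub> Gmat A a \<otimes>\<^bsub>SL2 A\<^esub> inv\<^bsub>SL2 A\<^esub> (Hmat A a)"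

section \<open>The chains\<close>

definition Theta :: "('a, 'm) ring_scheme \<Rightarrow> 'a \<Rightarrow> 'a mat2 list \<Rightarrow>\<^sub>0 int" where
  "Theta A a = frag_of [Hmat A a, Gmat A a] - frag_of [Rmat A a, Hmat A a]
             + frag_of [inv\<^bsub>SL2 A\<^esub> (wmat A), wmat A \<otimes>\<^bsub>SL2 A\<^esub> Gmat A a]"

definition Psi :: "('a, 'm) ring_scheme \<Rightarrow> 'a \<Rightarrow> 'a \<Rightarrow> 'a mat2 list \<Rightarrow>\<^sub>0 int" where
  "Psi A l x =
     (let x' = x \<otimes>\<^bsub>A\<^esub> inv\<^bsub>A\<^esub> (l [^]\<^bsub>A\<^esub> (2::nat) \<ominus>\<^bsub>A\<^esub> \<one>\<^bsub>A\<^esub>)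
      in frag_of [E12 A x, E12 A x' \<otimes>\<^bsub>SL2 A\<^esub> Dmat A l]
         - frag_of [Dmat A l, E12 A x'] + frag_of [E12 A x', Dmat A l])"

text \<open>The last \<open>\<Psi>\<close>-term has to be subtracted: since $d\Psi_x = [E_{12}(x)]$, and
  $(R_aR_b)^{-1}R_{ab} = E_{12}(y)$ for $y = (ab)^{-1}(a + b^{-1} - 1)$ enters \<open>d\<close> of the second
  summand with a plus sign, adding \<open>\<Psi>\<^sub>y\<close> instead would give a chain with boundary
  $2[E_{12}(y)] \neq 0$.\<close>

definition Fchain :: "('a, 'm) ring_scheme \<Rightarrow> 'a \<Rightarrow> 'a \<Rightarrow> 'a \<Rightarrow> 'a mat2 list \<Rightarrow>\<^sub>0 int" where
  "Fchain A l a b =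
     (let ab = a \<otimes>\<^bsub>A\<^esub> b; RaRb = Rmat A a \<otimes>\<^bsub>SL2 A\<^esub> Rmat A b
      in frag_of [Rmat A a, Rmat A b]
         + frag_of [RaRb, inv\<^bsub>SL2 A\<^esub> RaRb \<otimes>\<^bsub>SL2 A\<^esub> Rmat A ab]
         + Theta A a + Theta A b - Theta A ab - Theta A \<one>\<^bsub>A\<^esub>
         + Psi A l (ab \<oplus>\<^bsub>A\<^esub> inv\<^bsub>A\<^esub> ab)
         - Psi A l (a \<oplus>\<^bsub>A\<^esub> inv\<^bsub>A\<^esub> a)
         - Psi A l (b \<oplus>\<^bsub>A\<^esub> inv\<^bsub>A\<^esub> b)
         + Psi A l (\<one>\<^bsub>A\<^esub> \<oplus>\<^bsub>A\<^esub> \<one>\<^bsub>A\<^esub>)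
         - Psi A l (\<ominus>\<^bsub>A\<^esub> \<one>\<^bsub>A\<^esub>)
         - Psi A l (inv\<^bsub>A\<^esub> ab \<otimes>\<^bsub>A\<^esub> (a \<oplus>\<^bsub>A\<^esub> inv\<^bsub>A\<^esub> b \<ominus>\<^bsub>A\<^esub> \<one>\<^bsub>A\<^esub>)))"

definition Cclass :: "('a, 'm) ring_scheme \<Rightarrow> 'a \<Rightarrow> 'a \<Rightarrow> 'a \<Rightarrow> ('a mat2 list \<Rightarrow>\<^sub>0 int) set" where
  "Cclass A l a b = homology_class (SL2 A) 2 (Fchain A l a b)"

end

theory Submission
  imports Defs
begin

text \<open>Every \<open>\<Psi>\<^sub>x\<close> bounds \<open>[E\<^sub>1\<^sub>2(x)]\<close>, because conjugation by \<open>D(\<lambda>)\<close> carries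
  \<open>E\<^sub>1\<^sub>2(x')\<close> to \<open>E\<^sub>1\<^sub>2(\<lambda>\<^sup>2x') = E\<^sub>1\<^sub>2(x + x')\<close>. Conjugating \<open>G\<^sub>a\<close> to \<open>R\<^sub>a\<close> and factoring it through
  \<open>w\<close> shows that \<open>\<Theta>\<^sub>a\<close> has boundary \<open>- [R\<^sub>a] + [w\<^sup>-\<^sup>1] + [E\<^sub>1\<^sub>2(a + a\<^sup>-\<^sup>1)]\<close>. Hence everything cancels
  in the boundary of \<open>F(a,b)\<close> except \<open>[R\<^sub>1] - [E\<^sub>1\<^sub>2(-1)]\<close>, and \<open>R\<^sub>1 = E\<^sub>1\<^sub>2(-1)\<close>.\<close>

section \<open>Cycles and homology classes in the bar complex\<close>

lemma bar_boundary_add: "bar_boundary G (x + y) = bar_boundary G x + bar_boundary G y"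
  by (simp add: bar_boundary_def frag_extend_add)

lemma bar_boundary_diff: "bar_boundary G (x - y) = bar_boundary G x - bar_boundary G y"
  by (simp add: bar_boundary_def frag_extend_diff)

lemma frag_of_in_bar_chain_group:
  "length gs = n \<Longrightarrow> set gs \<subseteq> carrier G \<Longrightarrow> frag_of gs \<in> carrier (bar_chain_group G n)"
  by (simp add: bar_chain_group_def)

lemma add_in_bar_chain_group:
  assumes "x \<in> carrier (bar_chain_group G n)" "y \<in> carrier (bar_chain_group G n)"
  shows "x + y \<in> carrier (bar_chain_group G n)"
  using assms keys_add[of x y]
  unfolding bar_chain_group_def carrier_free_Abelian_group_iff by blast

lemma diff_in_bar_chain_group:
  assumes "x \<in> carrier (bar_chain_group G n)" "y \<in> carrier (bar_chain_group G n)"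
  shows "x - y \<in> carrier (bar_chain_group G n)"
  using assms keys_diff[of x y]
  unfolding bar_chain_group_def carrier_free_Abelian_group_iff by blast

text \<open>The unit of a free abelian group is \<open>0\<close>, so the kernel condition is the
  vanishing of the boundary.\<close>

lemma bar_cycles_iff:
  "z \<in> bar_cycles G n \<longleftrightarrow> z \<in> carrier (bar_chain_group G n) \<and> bar_boundary G z = 0"
  by (simp add: bar_cycles_def kernel_def bar_chain_group_def)

text \<open>Restricting the carrier to the cycles keeps the addition, so the coset formed in the
  chain group is also one of the cosets making up the quotient.\<close>

lemma homology_class_in_group_homology:
  "z \<in> bar_cycles G n \<Longrightarrow> homology_class G n z \<in> carrier (group_homology G n)"
  by (auto simp: homology_class_def group_homology_def FactGroup_def RCOSETS_def r_coset_def)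

section \<open>The group of unimodular two by two matrices\<close>

lemma Mat2_in_SL2_iff:
  "Mat2 p q r s \<in> carrier (SL2 A) \<longleftrightarrow>
     {p, q, r, s} \<subseteq> carrier A \<and> p \<otimes>\<^bsub>A\<^esub> s \<ominus>\<^bsub>A\<^esub> q \<otimes>\<^bsub>A\<^esub> r = \<one>\<^bsub>A\<^esub>"
  by (simp add: SL2_def)

lemma mult_SL2: "M \<otimes>\<^bsub>SL2 A\<^esub> N = mat2_mult A M N"
  by (simp add: SL2_def)

lemma one_SL2: "\<one>\<^bsub>SL2 A\<^esub> = Mat2 \<one>\<^bsub>A\<^esub> \<zero>\<^bsub>A\<^esub> \<zero>\<^bsub>A\<^esub> \<one>\<^bsub>A\<^esub>"
  by (simp add: SL2_def)

context cring
begin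

lemma mat2_det_mult:
  assumes "set_mat2 M \<subseteq> carrier R" "set_mat2 N \<subseteq> carrier R"
  shows "mat2_det R (mat2_mult R M N) = mat2_det R M \<otimes> mat2_det R N"
  using assms by (cases M; cases N) (simp, algebra)

lemma mat2_mult_closed:
  assumes "set_mat2 M \<subseteq> carrier R" "set_mat2 N \<subseteq> carrier R"
  shows "set_mat2 (mat2_mult R M N) \<subseteq> carrier R"
  using assms by (cases M; cases N) simp

lemma mat2_mult_assoc:
  assumes "set_mat2 L \<subseteq> carrier R" "set_mat2 M \<subseteq> carrier R" "set_mat2 N \<subseteq> carrier R"
  shows "mat2_mult R (mat2_mult R L M) N = mat2_mult R L (mat2_mult R M N)"
  using assms
  by (cases L; cases M; cases N) (simp add: l_distr r_distr m_assoc a_ac)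

text \<open>The diagonal entries of adjugate times matrix are the determinant, and the others cancel
  by commutativity. This gives the left inverse that \<open>groupI\<close> asks for.\<close>

lemma Mat2_adjugate_mult:
  assumes "Mat2 p q r s \<in> carrier (SL2 R)"
  shows "Mat2 s (\<ominus> q) (\<ominus> r) p \<otimes>\<^bsub>SL2 R\<^esub> Mat2 p q r s = \<one>\<^bsub>SL2 R\<^esub>"
proof -
  have c: "p \<in> carrier R" "q \<in> carrier R" "r \<in> carrier R" "s \<in> carrier R"
    and d: "p \<otimes> s \<ominus> q \<otimes> r = \<one>"
    using assms by (auto simp: Mat2_in_SL2_iff)
  have "s \<otimes> p \<oplus> \<ominus> q \<otimes> r = p \<otimes> s \<ominus> q \<otimes> r" "s \<otimes> q \<oplus> \<ominus> q \<otimes> s = \<zero>"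
    "\<ominus> r \<otimes> p \<oplus> p \<otimes> r = \<zero>" "\<ominus> r \<otimes> q \<oplus> p \<otimes> s = p \<otimes> s \<ominus> q \<otimes> r"
    using c by algebra+
  with d show ?thesis by (simp add: mult_SL2 one_SL2)
qed

lemma Mat2_adjugate_in_SL2:
  assumes "Mat2 p q r s \<in> carrier (SL2 R)"
  shows "Mat2 s (\<ominus> q) (\<ominus> r) p \<in> carrier (SL2 R)"
  using assms by (auto simp: Mat2_in_SL2_iff m_comm l_minus r_minus minus_eq)

lemma group_SL2: "group (SL2 R)"
proof (rule groupI)
  fix M N assume "M \<in> carrier (SL2 R)" "N \<in> carrier (SL2 R)"
  then show "M \<otimes>\<^bsub>SL2 R\<^esub> N \<in> carrier (SL2 R)"
    using mat2_det_mult mat2_mult_closed by (auto simp: SL2_def)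
next
  show "\<one>\<^bsub>SL2 R\<^esub> \<in> carrier (SL2 R)"
    by (simp add: one_SL2 Mat2_in_SL2_iff minus_eq)
next
  fix L M N assume "L \<in> carrier (SL2 R)" "M \<in> carrier (SL2 R)" "N \<in> carrier (SL2 R)"
  then show "L \<otimes>\<^bsub>SL2 R\<^esub> M \<otimes>\<^bsub>SL2 R\<^esub> N = L \<otimes>\<^bsub>SL2 R\<^esub> (M \<otimes>\<^bsub>SL2 R\<^esub> N)"
    using mat2_mult_assoc by (simp add: SL2_def)
next
  fix M assume M: "M \<in> carrier (SL2 R)"
  then show "\<one>\<^bsub>SL2 R\<^esub> \<otimes>\<^bsub>SL2 R\<^esub> M = M"
    by (cases M) (simp add: Mat2_in_SL2_iff mult_SL2 one_SL2)
  show "\<exists>N\<in>carrier (SL2 R). N \<otimes>\<^bsub>SL2 R\<^esub> M = \<one>\<^bsub>SL2 R\<^esub>"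
    using M Mat2_adjugate_mult Mat2_adjugate_in_SL2 by (cases M) blast
qed

lemma inv_Mat2_SL2:
  assumes "Mat2 p q r s \<in> carrier (SL2 R)"
  shows "inv\<^bsub>SL2 R\<^esub> (Mat2 p q r s) = Mat2 s (\<ominus> q) (\<ominus> r) p"
  by (rule group.inv_equality[OF group_SL2 Mat2_adjugate_mult assms Mat2_adjugate_in_SL2])
     (use assms in auto)

lemma E12_in_SL2: "x \<in> carrier R \<Longrightarrow> E12 R x \<in> carrier (SL2 R)"
  by (simp add: E12_def Mat2_in_SL2_iff minus_eq)

lemma Dmat_in_SL2: "u \<in> Units R \<Longrightarrow> Dmat R u \<in> carrier (SL2 R)"
  by (simp add: Dmat_def Mat2_in_SL2_iff minus_eq Units_closed)

lemma wmat_in_SL2: "wmat R \<in> carrier (SL2 R)"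
  by (simp add: wmat_def Mat2_in_SL2_iff minus_eq)

lemma Gmat_in_SL2: "a \<in> Units R \<Longrightarrow> Gmat R a \<in> carrier (SL2 R)"
  by (simp add: Gmat_def Mat2_in_SL2_iff minus_eq Units_closed)

lemma Hmat_in_SL2: "a \<in> carrier R \<Longrightarrow> Hmat R a \<in> carrier (SL2 R)"
  by (simp add: Hmat_def Mat2_in_SL2_iff minus_eq)

lemmas SL2_mats_closed = E12_in_SL2 Dmat_in_SL2 wmat_in_SL2 Gmat_in_SL2 Hmat_in_SL2

lemma Rmat_in_SL2:
  assumes "a \<in> Units R"
  shows "Rmat R a \<in> carrier (SL2 R)"
proof -
  interpret S: group "SL2 R" by (rule group_SL2)
  show ?thesis using assms by (simp add: Rmat_def SL2_mats_closed Units_closed)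
qed

lemma E12_mult:
  assumes "x \<in> carrier R" "y \<in> carrier R"
  shows "E12 R x \<otimes>\<^bsub>SL2 R\<^esub> E12 R y = E12 R (x \<oplus> y)"
  using assms by (simp add: E12_def mult_SL2 a_comm)

text \<open>Conjugation by \<open>Dmat R u\<close> scales the upper right entry by the square of
  \<open>u\<close>; it is stated as an equality of products because products are what appear in
  boundaries.\<close>

lemma Dmat_mult_E12:
  assumes "u \<in> Units R" "x \<in> carrier R"
  shows "Dmat R u \<otimes>\<^bsub>SL2 R\<^esub> E12 R x = E12 R (u [^] (2::nat) \<otimes> x) \<otimes>\<^bsub>SL2 R\<^esub> Dmat R u"
proof -
  \<comment> \<open>These are the upper right entries of the two products.\<close>
  have "u \<otimes> x = u [^] (2::nat) \<otimes> x \<otimes> inv u"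
    using assms Units_closed[OF assms(1)] Units_r_inv[OF assms(1)]
    by (simp add: numeral_2_eq_2 m_comm[of _ "inv u"] m_assoc[symmetric] Units_l_inv)
  then show ?thesis
    using assms by (simp add: E12_def Dmat_def mult_SL2 Units_closed)
qed

lemma wmat_mult_Gmat:
  assumes "a \<in> Units R"
  shows "wmat R \<otimes>\<^bsub>SL2 R\<^esub> Gmat R a = E12 R (a \<oplus> inv a)"
  using assms by (simp add: E12_def wmat_def Gmat_def mult_SL2 Units_closed l_minus r_minus)

text \<open>\<open>Gmat R a\<close> has determinant one and trace \<open>a \<oplus> inv a\<close>,
  hence characteristic roots \<open>a\<close> and \<open>inv a\<close>; conjugation by
  \<open>Hmat R a\<close> makes it triangular with these on the diagonal.\<close>

lemma Rmat_eq:
  assumes "a \<in> Units R"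
  shows "Rmat R a = Mat2 a (\<ominus> \<one>) \<zero> (inv a)"
proof -
  have a: "a \<in> carrier R" using assms by auto
  have i: "inv a \<in> carrier R" "a \<otimes> inv a = \<one>" using assms by auto
  have "inv\<^bsub>SL2 R\<^esub> (Hmat R a) = Mat2 \<one> \<zero> (\<ominus> a) \<one>"
    using a Hmat_in_SL2[OF a] by (simp add: Hmat_def inv_Mat2_SL2)
  \<comment> \<open>The left side is the lower left entry of the conjugate; the right side is
    zero.\<close>
  moreover have "\<one> \<oplus> (\<ominus> a \<oplus> (a \<oplus> inv a)) \<otimes> \<ominus> a = \<one> \<ominus> a \<otimes> inv a"
    using a i(1) by algebra
  moreover have "\<ominus> a \<oplus> (a \<oplus> inv a) = inv a"
    using a i(1) by algebra
  ultimately show ?thesis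
    using a i by (simp add: Rmat_def Hmat_def Gmat_def mult_SL2 l_minus r_minus minus_eq r_neg)
qed

text \<open>This makes the product terms of the first two symbols of \<open>Theta\<close>
  cancel.\<close>

lemma Rmat_mult_Hmat:
  assumes "a \<in> Units R"
  shows "Rmat R a \<otimes>\<^bsub>SL2 R\<^esub> Hmat R a = Hmat R a \<otimes>\<^bsub>SL2 R\<^esub> Gmat R a"
proof -
  interpret S: group "SL2 R" by (rule group_SL2)
  show ?thesis using assms
    by (simp add: Rmat_def S.m_assoc SL2_mats_closed Units_closed)
qed

text \<open>Both \<open>Rmat R a\<close> times \<open>Rmat R b\<close> and
  \<open>Rmat R (a \<otimes> b)\<close> are upper triangular with the same diagonal, so they differ
  by a unipotent factor; comparing upper right entries determines its parameter.\<close>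

lemma inv_Rmat_mult_Rmat:
  assumes "a \<in> Units R" "b \<in> Units R"
  shows "inv\<^bsub>SL2 R\<^esub> (Rmat R a \<otimes>\<^bsub>SL2 R\<^esub> Rmat R b) \<otimes>\<^bsub>SL2 R\<^esub> Rmat R (a \<otimes> b)
       = E12 R (inv (a \<otimes> b) \<otimes> (a \<oplus> inv b \<ominus> \<one>))"
proof -
  interpret S: group "SL2 R" by (rule group_SL2)
  let ?y = "inv (a \<otimes> b) \<otimes> (a \<oplus> inv b \<ominus> \<one>)"
  have c: "a \<in> carrier R" "b \<in> carrier R" "inv a \<in> carrier R" "inv b \<in> carrier R"
    using assms by auto
  have ab: "a \<otimes> b \<in> Units R" using assms by simp
  have "a \<otimes> b \<otimes> (inv a \<otimes> inv b) = (a \<otimes> inv a) \<otimes> (b \<otimes> inv b)"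
    using c by (simp add: m_ac)
  then have i: "inv (a \<otimes> b) = inv a \<otimes> inv b"
    using assms c by (intro comm_inv_char) simp_all
  have y: "?y \<in> carrier R" using c ab by simp
  have "a \<otimes> b \<otimes> ?y = a \<oplus> inv b \<ominus> \<one>"
    using c ab assms by (simp add: m_assoc[symmetric] Units_r_inv)
  \<comment> \<open>The left side is the upper right entry after multiplying by
    \<open>E12 R ?y\<close>; it must become that of \<open>Rmat R (a \<otimes> b)\<close>.\<close>
  then have "a \<otimes> b \<otimes> ?y \<oplus> (a \<otimes> \<ominus> \<one> \<oplus> \<ominus> \<one> \<otimes> inv b) = (a \<oplus> inv b \<ominus> \<one>) \<oplus> (\<ominus> a \<oplus> \<ominus> (inv b))"
    using c by (simp add: l_minus r_minus)
  also have "\<dots> = \<ominus> \<one>" using c by algebra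
  finally have "Rmat R a \<otimes>\<^bsub>SL2 R\<^esub> Rmat R b \<otimes>\<^bsub>SL2 R\<^esub> E12 R ?y = Rmat R (a \<otimes> b)"
    using assms ab c y i
    by (simp add: Rmat_eq E12_def mult_SL2)
  then show ?thesis
    using assms ab y by (metis Rmat_in_SL2 E12_in_SL2 S.inv_solve_left S.m_closed)
qed

section \<open>Boundaries of the chains\<close>

lemma Psi_in_bar_chain_group:
  assumes "l \<in> Units R" "l [^] (2::nat) \<ominus> \<one> \<in> Units R" "x \<in> carrier R"
  shows "Psi R l x \<in> carrier (bar_chain_group (SL2 R) 2)"
proof -
  interpret S: group "SL2 R" by (rule group_SL2)
  show ?thesis unfolding Psi_def Let_def using assms
    by (intro add_in_bar_chain_group diff_in_bar_chain_group frag_of_in_bar_chain_group)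
       (simp_all add: SL2_mats_closed)
qed

lemma bar_boundary_Psi:
  assumes "l \<in> Units R" "l [^] (2::nat) \<ominus> \<one> \<in> Units R" "x \<in> carrier R"
  shows "bar_boundary (SL2 R) (Psi R l x) = frag_of [E12 R x]"
proof -
  interpret S: group "SL2 R" by (rule group_SL2)
  define x' where "x' = x \<otimes> inv (l [^] (2::nat) \<ominus> \<one>)"
  have x': "x' \<in> carrier R" using assms by (simp add: x'_def)
  have l2: "l [^] (2::nat) \<in> carrier R" using assms by auto
  have "(l [^] (2::nat) \<ominus> \<one>) \<otimes> x' = x"
    using assms by (simp add: x'_def m_lcomm Units_closed)
  then have "l [^] (2::nat) \<otimes> x' \<ominus> x' = x"
    using x' l2 by (simp add: minus_eq l_distr l_minus)
  moreover have "l [^] (2::nat) \<otimes> x' = (l [^] (2::nat) \<otimes> x' \<ominus> x') \<oplus> x'"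
    using x' l2 by algebra
  ultimately have "l [^] (2::nat) \<otimes> x' = x \<oplus> x'" by simp
  \<comment> \<open>The first two symbols of \<open>Psi\<close> thus have equal products, which
    cancel; the third symbol cancels all that is left except \<open>[E12 R x]\<close>.\<close>
  then have "E12 R x \<otimes>\<^bsub>SL2 R\<^esub> (E12 R x' \<otimes>\<^bsub>SL2 R\<^esub> Dmat R l) = Dmat R l \<otimes>\<^bsub>SL2 R\<^esub> E12 R x'"
    using assms x'
    by (simp add: Dmat_mult_E12 S.m_assoc[symmetric] SL2_mats_closed E12_mult)
  then show ?thesis
    by (simp add: Psi_def Let_def x'_def[symmetric] bar_boundary_add bar_boundary_diff
        bar_boundary_degree_2)
qed

lemma Theta_in_bar_chain_group:
  assumes "a \<in> Units R"
  shows "Theta R a \<in> carrier (bar_chain_group (SL2 R) 2)"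
proof -
  interpret S: group "SL2 R" by (rule group_SL2)
  show ?thesis unfolding Theta_def using assms
    by (intro add_in_bar_chain_group diff_in_bar_chain_group frag_of_in_bar_chain_group)
       (simp_all add: SL2_mats_closed Rmat_in_SL2 Units_closed)
qed

lemma bar_boundary_Theta:
  assumes "a \<in> Units R"
  shows "bar_boundary (SL2 R) (Theta R a)
       = frag_of [inv\<^bsub>SL2 R\<^esub> (wmat R)] + frag_of [E12 R (a \<oplus> inv a)] - frag_of [Rmat R a]"
proof -
  interpret S: group "SL2 R" by (rule group_SL2)
  \<comment> \<open>The product of the third symbol cancels the \<open>[Gmat R a]\<close> left by
    the first two.\<close>
  have "inv\<^bsub>SL2 R\<^esub> (wmat R) \<otimes>\<^bsub>SL2 R\<^esub> (wmat R \<otimes>\<^bsub>SL2 R\<^esub> Gmat R a) = Gmat R a"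
    using assms by (simp add: S.m_assoc[symmetric] SL2_mats_closed)
  then show ?thesis
    using assms
    by (simp add: Theta_def bar_boundary_add bar_boundary_diff bar_boundary_degree_2
        Rmat_mult_Hmat wmat_mult_Gmat)
qed

lemma Fchain_in_bar_cycles:
  assumes l: "l \<in> Units R" "l [^] (2::nat) \<ominus> \<one> \<in> Units R"
    and a: "a \<in> Units R" and b: "b \<in> Units R"
  shows "Fchain R l a b \<in> bar_cycles (SL2 R) 2"
proof -
  interpret S: group "SL2 R" by (rule group_SL2)
  have ab: "a \<otimes> b \<in> Units R" using a b by simp
  have c: "a \<in> carrier R" "b \<in> carrier R" "inv a \<in> carrier R" "inv b \<in> carrier R"
    "inv (a \<otimes> b) \<in> carrier R"
    using a b ab by auto
  have "Fchain R l a b \<in> carrier (bar_chain_group (SL2 R) 2)"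
    unfolding Fchain_def Let_def using l a b ab c
    by (intro add_in_bar_chain_group diff_in_bar_chain_group frag_of_in_bar_chain_group
          Theta_in_bar_chain_group Psi_in_bar_chain_group)
       (simp_all add: Rmat_in_SL2)
  moreover have "bar_boundary (SL2 R) (Fchain R l a b) = 0"
  proof -
    have y: "inv (a \<otimes> b) \<otimes> (a \<oplus> inv b \<ominus> \<one>) \<in> carrier R"
      using c by simp
    \<comment> \<open>With this product the first two symbols of \<open>Fchain\<close> leave
      \<open>[R_a] + [R_b] - [R_ab]\<close> and a unipotent term, which the last \<open>Psi\<close>
      removes.\<close>
    have Rab: "Rmat R a \<otimes>\<^bsub>SL2 R\<^esub> Rmat R b \<otimes>\<^bsub>SL2 R\<^esub>
        E12 R (inv (a \<otimes> b) \<otimes> (a \<oplus> inv b \<ominus> \<one>)) = Rmat R (a \<otimes> b)"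
      unfolding inv_Rmat_mult_Rmat[OF a b, symmetric]
      using a b ab by (simp add: S.m_assoc[symmetric] Rmat_in_SL2)
    \<comment> \<open>Subtracting \<open>Theta R \<one>\<close> balances the copies of the inverse
      of \<open>w\<close> but brings in \<open>[R_1]\<close> and
      \<open>- [E12 R (\<one> \<oplus> \<one>)]\<close>; the \<open>Psi\<close> at
      \<open>\<ominus> \<one>\<close> removes the former by this equality, and the one at
      \<open>\<one> \<oplus> \<one>\<close> the latter.\<close>
    have R1: "Rmat R \<one> = E12 R (\<ominus> \<one>)"
      by (simp add: Rmat_eq E12_def)
    show ?thesis
      using l a b ab c y
      by (simp add: Fchain_def Let_def bar_boundary_add bar_boundary_diff bar_boundary_degree_2
          bar_boundary_Psi bar_boundary_Theta inv_Rmat_mult_Rmat Rab R1)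
  qed
  ultimately show ?thesis by (simp add: bar_cycles_iff)
qed

end

theorem proposition7p1:
  fixes A :: "('a, 'm) ring_scheme" and l a b :: 'a
  assumes "cring A"
    and "l \<in> Units A"
    and "l [^]\<^bsub>A\<^esub> (2::nat) \<ominus>\<^bsub>A\<^esub> \<one>\<^bsub>A\<^esub> \<in> Units A"
    and "a \<in> Units A"
    and "b \<in> Units A"
  shows "Fchain A l a b \<in> bar_cycles (SL2 A) 2 \<and>
         Cclass A l a b \<in> carrier (group_homology (SL2 A) 2)"
  using cring.Fchain_in_bar_cycles[OF assms] homology_class_in_group_homology
  by (auto simp: Cclass_def)

end
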